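(* For $m \geq 2$, we have $$ \mathsf{D}^{(4)} ( \{-m,\dots,m\}^3) \geq \left\{ \begin{array}{ll} 16m^3 - 16m^2 +10m-2 & \text{if } m \text{ is odd,} \\ 16m^3 - 16m^2 +8m-1 & \text{if } m \text{ is even.} \end{array} \right. $$
   Context: For a subset $X$ of an abelian group, a minimal zero-sum sequence over $X$ is a (unordered) sequence of elements of $X$ summing to $0$ with no non-empty proper subsequence summing to $0$. $\mathsf{D}^{(k)}(X)$ denotes the maximal length of a minimal zero-sum sequence over $X$ whose support (set of distinct elements) has size exactly $k$. $\{-m,\dots,m\}$ denotes the set of integers $i$ with $-m\le i\le m$. *)

theory Defs
  imports Complex_Main "HOL-Library.Multiset" "HOL-Library.Product_Plus"
begin

text \<open>
  Unordered sequences are finite multisets, their subsequences are sub-multisets.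
\<close>

definition min_zero_sum_over :: "'a::ab_group_add set \<Rightarrow> 'a multiset \<Rightarrow> bool" where
  "min_zero_sum_over X S \<longleftrightarrow>
     set_mset S \<subseteq> X \<and> S \<noteq> {#} \<and> sum_mset S = 0 \<and>
     (\<forall>T. T \<subset># S \<and> T \<noteq> {#} \<longrightarrow> sum_mset T \<noteq> 0)"

text \<open>
  The maximum below is meaningful only if the set of lengths is finite and non-empty. Finiteness
  holds for every finite \<open>X\<close> by Dickson's lemma, see \<open>finite_min_zero_sum_lengths\<close>.
\<close>

definition davenport_supp :: "nat \<Rightarrow> 'a::ab_group_add set \<Rightarrow> nat" where
  "davenport_supp k X = Max {size S |S. min_zero_sum_over X S \<and> card (set_mset S) = k}"

lemma nat_mono_subseq:
  fixes s :: "nat \<Rightarrow> nat"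
  shows "\<exists>r :: nat \<Rightarrow> nat. strict_mono r \<and> mono (\<lambda>n. s (r n))"
proof -
  obtain f where f: "strict_mono f" "monoseq (\<lambda>n. s (f n))"
    using seq_monosub by blast
  show ?thesis
  proof (cases "incseq (\<lambda>n. s (f n))")
    case True
    then show ?thesis using f(1) by blast
  next
    case False
    then have dec: "decseq (\<lambda>n. s (f n))"
      using f(2) by (simp add: monoseq_iff)
    define M where "M = (LEAST v. v \<in> range (\<lambda>n. s (f n)))"
    have "M \<in> range (\<lambda>n. s (f n))"
      unfolding M_def by (rule LeastI_ex) blast
    then obtain N where N: "s (f N) = M" by auto
    have "s (f (N + n)) = M" for n
    proof (rule antisym)
      show "s (f (N + n)) \<le> M"
        using decseqD[OF dec, of N "N + n"] N by simp
      show "M \<le> s (f (N + n))"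
        unfolding M_def by (rule Least_le) blast
    qed
    moreover have "strict_mono (\<lambda>n. f (N + n))"
      using f(1) by (simp add: strict_mono_def)
    ultimately show ?thesis
      by (intro exI[of _ "\<lambda>n. f (N + n)"]) (simp add: mono_def)
  qed
qed

lemma dickson_mono_subseq:
  fixes g :: "nat \<Rightarrow> 'a \<Rightarrow> nat"
  assumes "finite X"
  shows "\<exists>r :: nat \<Rightarrow> nat. strict_mono r \<and> (\<forall>x\<in>X. mono (\<lambda>n. g (r n) x))"
  using assms
proof (induction X)
  case empty
  show ?case by (intro exI[of _ id]) (simp add: strict_mono_def)
next
  case (insert y X)
  then obtain r :: "nat \<Rightarrow> nat" where r: "strict_mono r" "\<forall>x\<in>X. mono (\<lambda>n. g (r n) x)" by blast
  obtain q :: "nat \<Rightarrow> nat" where q: "strict_mono q" "mono (\<lambda>n. g (r (q n)) y)"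
    using nat_mono_subseq[of "\<lambda>n. g (r n) y"] by blast
  have "mono (\<lambda>n. g (r (q n)) x)" if "x \<in> X" for x
    using r(2) that strict_mono_mono[OF q(1)] by (auto simp: mono_def)
  moreover have "strict_mono (\<lambda>n. r (q n))"
    using r(1) q(1) by (simp add: strict_mono_def)
  ultimately show ?case
    using q(2) by (intro exI[of _ "\<lambda>n. r (q n)"]) auto
qed

lemma finite_min_zero_sum_over:
  assumes "finite X"
  shows "finite {S. min_zero_sum_over X S}"
proof (rule ccontr)
  assume "infinite {S. min_zero_sum_over X S}"
  then obtain h :: "nat \<Rightarrow> 'a multiset"
    where h: "inj h" "range h \<subseteq> {S. min_zero_sum_over X S}"
    by (metis infinite_countable_subset)
  obtain r :: "nat \<Rightarrow> nat" where r: "strict_mono r" "\<forall>x\<in>X. mono (\<lambda>n. count (h (r n)) x)"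
    using dickson_mono_subseq[OF assms, of "\<lambda>n. count (h n)"] by blast
  let ?S = "h (r 0)" and ?T = "h (r 1)"
  have S: "min_zero_sum_over X ?S" and T: "min_zero_sum_over X ?T"
    using h(2) by auto
  have "count ?S x \<le> count ?T x" for x
  proof (cases "x \<in> X")
    case True
    then show ?thesis using r(2) by (auto simp: mono_def)
  next
    case False
    then have "x \<notin># ?S" using S by (auto simp: min_zero_sum_over_def)
    then show ?thesis by (simp add: not_in_iff)
  qed
  then have "?S \<subseteq># ?T" by (simp add: mset_subset_eqI)
  moreover have "?S \<noteq> ?T"
    using h(1) strict_mono_less[OF r(1), of 0 1] by (auto dest: injD)
  ultimately have "?S \<subset># ?T" by (simp add: subset_mset.less_le)
  then show False using S T by (auto simp: min_zero_sum_over_def)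
qed

lemma finite_min_zero_sum_lengths:
  assumes "finite X"
  shows "finite {size S |S. min_zero_sum_over X S \<and> card (set_mset S) = k}"
proof (rule finite_subset)
  show "{size S |S. min_zero_sum_over X S \<and> card (set_mset S) = k}
      \<subseteq> size ` {S. min_zero_sum_over X S}" by blast
  show "finite (size ` {S. min_zero_sum_over X S})"
    using finite_min_zero_sum_over[OF assms] by simp
qed

end

theory Submission
  imports Defs
begin

text \<open>
  If four vectors in \<open>\<int>\<^sup>3\<close> have signed \<open>3 \<times> 3\<close> minors that are positive and jointly coprime, then
  by Cramer's rule these minors generate the lattice of integer relations between the vectors, so
  the sequence with these multiplicities is a minimal zero-sum sequence. Its length, the sum of
  the minors, is almost as large as possible for a small perturbation of \<open>m\<close> times the
  vertices of a regular tetrahedron, for which all four minors equal \<open>4 * m^3\<close>. The perturbation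
  makes the minors coprime; the best choice depends on the parity of \<open>m\<close>.
\<close>

type_synonym vec3 = "int \<times> int \<times> int"

fun det3 :: "vec3 \<Rightarrow> vec3 \<Rightarrow> vec3 \<Rightarrow> int" where
  "det3 (a1, a2, a3) (b1, b2, b3) (c1, c2, c3) =
     a1 * (b2 * c3 - b3 * c2) - a2 * (b1 * c3 - b3 * c1) + a3 * (b1 * c2 - b2 * c1)"

fun scale3 :: "int \<Rightarrow> vec3 \<Rightarrow> vec3" where
  "scale3 t (a1, a2, a3) = (t * a1, t * a2, t * a3)"

lemma sum_mset_replicate_vec3:
  "sum_mset (replicate_mset n v) = scale3 (int n) v"
  by (cases v, induction n) (auto simp: algebra_simps zero_prod_def)

text \<open>Each coordinate is the Laplace expansion of a 4 by 4 determinant with two equal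
  rows.\<close>

lemma scale3_det3_sum:
  "scale3 (- det3 u2 u3 u4) u1 + scale3 (det3 u1 u3 u4) u2
     + scale3 (- det3 u1 u2 u4) u3 + scale3 (det3 u1 u2 u3) u4 = 0"
  by (cases u1; cases u2; cases u3; cases u4) (simp add: zero_prod_def algebra_simps)

text \<open>The map \<open>det3 _ v w\<close> is linear: it is the scalar product with the cross
  product of \<open>v\<close> and \<open>w\<close>, so it can be applied to the relation.\<close>

lemma relation_det3:
  assumes "scale3 t1 u1 + scale3 t2 u2 + scale3 t3 u3 + scale3 t4 u4 = 0"
  shows "t1 * det3 u1 v w + t2 * det3 u2 v w + t3 * det3 u3 v w + t4 * det3 u4 v w = 0"
proof -
  obtain a1 a2 a3 b1 b2 b3 c1 c2 c3 d1 d2 d3 v1 v2 v3 w1 w2 w3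
    where u: "u1 = (a1, a2, a3)" "u2 = (b1, b2, b3)" "u3 = (c1, c2, c3)" "u4 = (d1, d2, d3)"
      "v = (v1, v2, v3)" "w = (w1, w2, w3)"
    by (metis prod_cases3)
  have "t1 * a1 + t2 * b1 + t3 * c1 + t4 * d1 = 0" "t1 * a2 + t2 * b2 + t3 * c2 + t4 * d2 = 0"
    "t1 * a3 + t2 * b3 + t3 * c3 + t4 * d3 = 0"
    using assms by (simp_all add: u zero_prod_def)
  then have "(t1 * a1 + t2 * b1 + t3 * c1 + t4 * d1) * (v2 * w3 - v3 * w2)
      - (t1 * a2 + t2 * b2 + t3 * c2 + t4 * d2) * (v1 * w3 - v3 * w1)
      + (t1 * a3 + t2 * b3 + t3 * c3 + t4 * d3) * (v1 * w2 - v2 * w1) = 0"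
    by simp
  then show ?thesis by (simp add: u algebra_simps)
qed

lemma det3_eq_args [simp]: "det3 u u v = 0" "det3 u v u = 0" "det3 v u u = 0"
  by (cases u; cases v; simp add: right_diff_distrib mult_ac)+

lemma det3_swap12: "det3 v u w = - det3 u v w"
  by (cases u; cases v; cases w; simp add: right_diff_distrib mult_ac)

lemma det3_swap23: "det3 u w v = - det3 u v w"
  by (cases u; cases v; cases w; simp add: right_diff_distrib mult_ac)

text \<open>Taking two of the four vectors as \<open>v\<close> and \<open>w\<close> in
  \<open>relation_det3\<close> kills two terms. The swap rules turn the other two determinants into
  signed minors.\<close>

lemma relation_proportional:
  assumes "scale3 t1 u1 + scale3 t2 u2 + scale3 t3 u3 + scale3 t4 u4 = 0"
    and x: "x1 = - det3 u2 u3 u4" "x2 = det3 u1 u3 u4"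
      "x3 = - det3 u1 u2 u4" "x4 = det3 u1 u2 u3"
  shows "t1 * x2 = t2 * x1" "t1 * x3 = t3 * x1" "t1 * x4 = t4 * x1"
    "t2 * x3 = t3 * x2" "t2 * x4 = t4 * x2" "t3 * x4 = t4 * x3"
  using relation_det3[OF assms(1), of u3 u4] relation_det3[OF assms(1), of u2 u4]
    relation_det3[OF assms(1), of u2 u3] relation_det3[OF assms(1), of u1 u4]
    relation_det3[OF assms(1), of u1 u3] relation_det3[OF assms(1), of u1 u2]
  by (simp_all add: x
    det3_swap12[where u = u1 and v = u2] det3_swap23[where v = u1 and w = u2]
    det3_swap12[where u = u1 and v = u3] det3_swap23[where v = u1 and w = u3]
    det3_swap12[where u = u2 and v = u3] det3_swap23[where v = u2 and w = u3]
    det3_swap12[where u = u1 and v = u4] det3_swap23[where v = u1 and w = u4]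
    det3_swap12[where u = u2 and v = u4] det3_swap23[where v = u2 and w = u4]
    det3_swap12[where u = u3 and v = u4] det3_swap23[where v = u3 and w = u4])

lemma davenport_supp_4_ge:
  fixes X :: "vec3 set"
  assumes "finite X" and X: "{u1, u2, u3, u4} \<subseteq> X"
    and x: "x1 = - det3 u2 u3 u4" "x2 = det3 u1 u3 u4"
      "x3 = - det3 u1 u2 u4" "x4 = det3 u1 u2 u3"
    and pos: "x1 > 0" "x2 > 0" "x3 > 0" "x4 > 0"
    and bezout: "p1 * x1 + p2 * x2 + p3 * x3 + p4 * x4 = 1"
  shows "int (davenport_supp 4 X) \<ge> x1 + x2 + x3 + x4"
proof -
  \<comment> \<open>Any two of the vectors occur together in some minor, which would vanish if they
    were equal.\<close>
  have dist: "u1 \<noteq> u2" "u1 \<noteq> u3" "u1 \<noteq> u4" "u2 \<noteq> u3" "u2 \<noteq> u4" "u3 \<noteq> u4"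
    using pos by (auto simp: x)
  define R where "R n1 n2 n3 n4 = replicate_mset n1 u1 + replicate_mset n2 u2
    + replicate_mset n3 u3 + replicate_mset n4 u4" for n1 n2 n3 n4
  define S where "S = R (nat x1) (nat x2) (nat x3) (nat x4)"
  have sum_R: "sum_mset (R n1 n2 n3 n4) = scale3 (int n1) u1 + scale3 (int n2) u2
      + scale3 (int n3) u3 + scale3 (int n4) u4" for n1 n2 n3 n4
    by (simp add: R_def sum_mset_replicate_vec3)
  have count_R: "count (R n1 n2 n3 n4) u1 = n1" "count (R n1 n2 n3 n4) u2 = n2"
    "count (R n1 n2 n3 n4) u3 = n3" "count (R n1 n2 n3 n4) u4 = n4"
    "v \<notin> {u1, u2, u3, u4} \<Longrightarrow> count (R n1 n2 n3 n4) v = 0" for n1 n2 n3 n4 v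
    using dist by (auto simp: R_def)
  have set_S: "set_mset S = {u1, u2, u3, u4}"
    using pos by (auto simp: S_def R_def)
  have size_S: "int (size S) = x1 + x2 + x3 + x4"
    using pos by (simp add: S_def R_def)
  have "sum_mset S = 0"
    using scale3_det3_sum[of u2 u3 u4 u1] pos by (simp add: S_def sum_R x)
  moreover have "sum_mset T \<noteq> 0" if T: "T \<subset># S" "T \<noteq> {#}" for T
  proof
    assume "sum_mset T = 0"
    have le: "count T v \<le> count S v" for v
      using T(1) by (simp add: mset_subset_eq_count subset_mset.less_imp_le)
    have T_eq: "T = R (count T u1) (count T u2) (count T u3) (count T u4)"
    proof (rule multiset_eqI)
      fix v
      show "count T v = count (R (count T u1) (count T u2) (count T u3) (count T u4)) v"
        using le[of v] count_R by (cases "v \<in> {u1, u2, u3, u4}") (auto simp: S_def)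
    qed
    define t1 t2 t3 t4 where t: "t1 = int (count T u1)" "t2 = int (count T u2)"
      "t3 = int (count T u3)" "t4 = int (count T u4)"
    have "scale3 t1 u1 + scale3 t2 u2 + scale3 t3 u3 + scale3 t4 u4 = 0"
      using \<open>sum_mset T = 0\<close> T_eq sum_R unfolding t by metis
    note cross = relation_proportional[OF this x]
    \<comment> \<open>By \<open>cross\<close>, \<open>l * x1\<close> equals \<open>t1\<close> times
      the Bezout sum, hence \<open>t1\<close>; likewise for the other indices. So integrality of
      \<open>l\<close> comes from coprimality of the minors.\<close>
    define l where "l = p1 * t1 + p2 * t2 + p3 * t3 + p4 * t4"
    have l: "t1 = l * x1" "t2 = l * x2" "t3 = l * x3" "t4 = l * x4"
    proof -
      have "t * (p1 * x1 + p2 * x2 + p3 * x3 + p4 * x4)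
          = p1 * (t * x1) + p2 * (t * x2) + p3 * (t * x3) + p4 * (t * x4)" for t
        by (simp add: algebra_simps)
      then have expand: "t = p1 * (t * x1) + p2 * (t * x2) + p3 * (t * x3) + p4 * (t * x4)" for t
        by (simp add: bezout)
      show "t1 = l * x1" "t2 = l * x2" "t3 = l * x3" "t4 = l * x4"
        by (subst expand, simp add: l_def cross algebra_simps)+
    qed
    \<comment> \<open>As \<open>x1 > 0\<close>, the multiplicity of \<open>u1\<close> alone confines
      \<open>l\<close> to 0 and 1, that is, \<open>T\<close> to the empty sequence and
      \<open>S\<close>.\<close>
    have "0 \<le> t1" "t1 \<le> x1"
      using le[of u1] pos by (auto simp: t S_def count_R)
    then have "0 \<le> l" "l \<le> 1"
      using pos(1) by (simp_all add: l zero_le_mult_iff mult_le_cancel_right1)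
    then consider "l = 0" | "l = 1" by linarith
    then show False
    proof cases
      case 1
      then have "T = R 0 0 0 0" using T_eq l by (simp add: t)
      then show False using T(2) by (simp add: R_def)
    next
      case 2
      then have "T = S" using T_eq l unfolding S_def t
        by (metis mult_1 nat_int)
      then show False using T(1) by simp
    qed
  qed
  ultimately have "min_zero_sum_over X S"
    using X set_S by (auto simp: min_zero_sum_over_def)
  moreover have "card (set_mset S) = 4"
    using dist by (simp add: set_S)
  ultimately have "size S \<le> davenport_supp 4 X"
    unfolding davenport_supp_def
    using finite_min_zero_sum_lengths[OF \<open>finite X\<close>] by (intro Max_ge) auto
  then show ?thesis using size_S by linarith
qed

theorem theorem8:
  fixes m :: int
  assumes "m \<ge> 2"
  shows "int (davenport_supp 4 ({-m..m} \<times> {-m..m} \<times> {-m..m})) \<ge>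
    (if odd m then 16 * m^3 - 16 * m^2 + 10 * m - 2
     else 16 * m^3 - 16 * m^2 + 8 * m - 1)"
proof -
  \<comment> \<open>Rewritten in \<open>n\<close>, all the minors have nonnegative coefficients and
    a positive constant term, which makes their positivity evident.\<close>
  define n where "n = nat (m - 2)"
  have m: "m = int n + 2" using assms by (simp add: n_def)
  show ?thesis
  proof (cases "odd m")
    case True
    then obtain k where k: "m = 2 * k + 1" by (rule oddE)
    define q where "q = 4 * m^2 - 8 * m + 5"
    \<comment> \<open>The difference of the first two minors is \<open>m\<close> and the third one is \<open>m * q - 2\<close>,
        hence a unit modulo every divisor of the odd number \<open>m\<close>.\<close>
    have "4 * m^3 - 2 * m^2 + m + (4 * m^3 - 2 * m^2 + 2 * m)
        + (4 * m^3 - 8 * m^2 + 5 * m - 2) + (4 * m^3 - 4 * m^2 + 2 * m)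
        \<le> int (davenport_supp 4 ({-m..m} \<times> {-m..m} \<times> {-m..m}))"
    proof (rule davenport_supp_4_ge)
      \<comment> \<open>The unperturbed vertices are \<open>m\<close> times (1,1,1), (1,-1,-1),
        (-1,1,-1), (-1,-1,1). Coordinates only move towards 0, so the vectors stay in the
        cube.\<close>
      show "{(m - 2, m, m), (m, - (m - 1), - m), (- m, m, - m), (- m, - m, m - 1)}
          \<subseteq> {-m..m} \<times> {-m..m} \<times> {-m..m}"
        using assms by auto
      \<comment> \<open>This amounts to
        \<open>(1 - k * q) * m + k * (m * q - 2) = m - 2 * k = 1\<close>.\<close>
      show "(k * q - 1) * (4 * m^3 - 2 * m^2 + m) + (1 - k * q) * (4 * m^3 - 2 * m^2 + 2 * m)
          + k * (4 * m^3 - 8 * m^2 + 5 * m - 2) + 0 * (4 * m^3 - 4 * m^2 + 2 * m) = 1"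
        using k unfolding q_def by algebra
    qed (auto simp: m algebra_simps power2_eq_square power3_eq_cube
        intro!: add_pos_nonneg add_nonneg_nonneg mult_nonneg_nonneg)
    then show ?thesis using True by simp
  next
    case False
    define q where "q = 4 * m^2 - 6 * m + 4"
    \<comment> \<open>The second minor minus the fourth is \<open>m\<close>, and the third one is \<open>m * q - 1\<close>.\<close>
    have "4 * m^3 - 2 * m^2 + m + (4 * m^3 - 4 * m^2 + 2 * m)
        + (4 * m^3 - 6 * m^2 + 4 * m - 1) + (4 * m^3 - 4 * m^2 + m)
        \<le> int (davenport_supp 4 ({-m..m} \<times> {-m..m} \<times> {-m..m}))"
    proof (rule davenport_supp_4_ge)
      show "{(m - 1, m - 1, m), (m, - (m - 1), - m), (- m, m, - m), (- m, - m, m - 1)}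
          \<subseteq> {-m..m} \<times> {-m..m} \<times> {-m..m}"
        using assms by auto
      show "0 * (4 * m^3 - 2 * m^2 + m) + q * (4 * m^3 - 4 * m^2 + 2 * m)
          + (- 1) * (4 * m^3 - 6 * m^2 + 4 * m - 1) + (- q) * (4 * m^3 - 4 * m^2 + m) = 1"
        unfolding q_def by algebra
    qed (auto simp: m algebra_simps power2_eq_square power3_eq_cube
        intro!: add_pos_nonneg add_nonneg_nonneg mult_nonneg_nonneg)
    then show ?thesis using False by simp
  qed
qed

end
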